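(* Fix prescribed geometry at a face node: $\alpha>0$, $\beta\in\mathbb R^2$, a symmetric positive definite matrix $(\gamma_{IJ})$ with inverse $(\gamma^{IJ})$, and $w>0$; let $n=\varepsilon e_I$ with $\varepsilon\in\{-1,1\}$, $I\in\{1,2\}$, be the face normal covector. Let $\mathbb W^-=wj_2\widehat U^-$ and $\mathbb W^+=wj_2\widehat U^+$ be two admissible states sharing this geometry. Define the local Lax--Friedrichs flux with the geometry-only causal speed by $$\widehat{\mathbb H}^{\mathrm{LLF}}_n=\frac12(\mathbb H_n^-+\mathbb H_n^+)-\frac{a_f}{2}(\mathbb W^+-\mathbb W^-),\qquad a_f=|\beta^In_I|+\alpha\sqrt{\gamma^{IJ}n_In_J}.$$ Then $$(V^+-V^-)^T\,\widehat{\mathbb H}^{\mathrm{LLF}}_n-(\Psi_{w,n}^+-\Psi_{w,n}^-)\le 0 .$$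
   Context: Indices $I,J,a\in\{1,2\}$; repeated indices are summed. Fix $1<\Gamma\le 2$. Fluid state. For $\rho>0$, $p>0$, $\widehat v\in\mathbb R^2$ with $|\widehat v|<1$ put $L=(1-|\widehat v|^2)^{-1/2}$, $h=1+\frac{\Gamma p}{(\Gamma-1)\rho}$, $D=\rho L$, $\widehat m=\rho hL^2\widehat v$, $E=\rho hL^2-p$, $\widehat U=(D,\widehat m_1,\widehat m_2,E)^T$ and $\widehat F^a=(D\widehat v_a,\ \widehat m_1\widehat v_a+p\delta_{1a},\ \widehat m_2\widehat v_a+p\delta_{2a},\ \widehat m_a)^T$. Such states $\widehat U$ are called admissible; $(\rho,\widehat v,p)$ is uniquely determined by $\widehat U$. With $s=\log p-\Gamma\log\rho$ and $\zeta=\rho/p$, the entropy is $\widehat\eta=-Ds/(\Gamma-1)$, the entropy variables are $V=\nabla_{\widehat U}\widehat\eta=\bigl(\frac{\Gamma-s}{\Gamma-1}+\zeta,\ \zeta L\widehat v_1,\ \zeta L\widehat v_2,\ -\zeta L\bigr)^T$, and the local potentials are $\Phi=D$, $\psi_a=D\widehat v_a$. Geometry. $j_2=\sqrt{\det(\gamma_{IJ})}$; $\Theta$ is the upper-triangular matrix with positive diagonal such that $\Theta^T\Theta=(\gamma_{IJ})^{-1}$; $A_{aI}=\alpha j_2\Theta_{aI}$, $C^I=j_2\beta^I$, $\mathcal A_{aI}=wA_{aI}$, $\mathcal C^I=wC^I$. The state $\mathbb W=wj_2\widehat U$ is admissible when $\widehat U$ is. The weighted flux is $\mathbb H^I=\mathcal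 A_{aI}\widehat F^a-\mathcal C^I\widehat U$ and the weighted entropy potential is $\Psi_w^I=\mathcal A_{aI}\psi_a-\mathcal C^I\Phi$; the normal quantities are $\mathbb H_n=n_I\mathbb H^I$, $\Psi_{w,n}=n_I\Psi_w^I$. Superscripts $\pm$ denote evaluation at the two states. *)

theory Defs
  imports "HOL-Analysis.Analysis"
begin

section \<open>Fluid states\<close>

text \<open>Throughout, \<open>\<Gamma>\<close> is the adiabatic index, \<open>\<rho>\<close> the rest-mass density, \<open>v\<close> the velocity in an
  orthonormal frame and \<open>p\<close> the pressure. A state is a vector \<open>(D, m\<^sub>1, m\<^sub>2, E)\<close> of type \<open>real ^ 4\<close>.\<close>

definition lorentz_factor :: "real ^ 2 \<Rightarrow> real" where
  "lorentz_factor v = 1 / sqrt (1 - (norm v)\<^sup>2)"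

definition specific_enthalpy :: "real \<Rightarrow> real \<Rightarrow> real \<Rightarrow> real" where
  "specific_enthalpy \<Gamma> \<rho> p = 1 + \<Gamma> * p / ((\<Gamma> - 1) * \<rho>)"

definition physical :: "real \<Rightarrow> real ^ 2 \<Rightarrow> real \<Rightarrow> bool" where
  "physical \<rho> v p \<longleftrightarrow> \<rho> > 0 \<and> norm v < 1 \<and> p > 0"

definition conserved :: "real \<Rightarrow> real \<Rightarrow> real ^ 2 \<Rightarrow> real \<Rightarrow> real ^ 4" where
  "conserved \<Gamma> \<rho> v p =
    (let L = lorentz_factor v; h = specific_enthalpy \<Gamma> \<rho> p
     in vector [\<rho> * L, \<rho> * h * L\<^sup>2 * v $ 1, \<rho> * h * L\<^sup>2 * v $ 2, \<rho> * h * L\<^sup>2 - p])"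

definition admissible :: "real \<Rightarrow> real ^ 4 \<Rightarrow> bool" where
  "admissible \<Gamma> U \<longleftrightarrow> (\<exists>\<rho> v p. physical \<rho> v p \<and> U = conserved \<Gamma> \<rho> v p)"

text \<open>The description below is proper for admissible \<open>U\<close> and \<open>1 < \<Gamma> \<le> 2\<close>,
  see \<open>primitives_conserved\<close>.\<close>

definition primitives :: "real \<Rightarrow> real ^ 4 \<Rightarrow> real \<times> (real ^ 2) \<times> real" where
  "primitives \<Gamma> U = (THE (\<rho>, v, p). physical \<rho> v p \<and> U = conserved \<Gamma> \<rho> v p)"

definition rest_density :: "real \<Rightarrow> real ^ 4 \<Rightarrow> real" where
  "rest_density \<Gamma> U = fst (primitives \<Gamma> U)"

definition velocity :: "real \<Rightarrow> real ^ 4 \<Rightarrow> real ^ 2" where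
  "velocity \<Gamma> U = fst (snd (primitives \<Gamma> U))"

definition pressure :: "real \<Rightarrow> real ^ 4 \<Rightarrow> real" where
  "pressure \<Gamma> U = snd (snd (primitives \<Gamma> U))"

definition flux :: "real \<Rightarrow> 2 \<Rightarrow> real ^ 4 \<Rightarrow> real ^ 4" where
  "flux \<Gamma> a U =
    (let v = velocity \<Gamma> U; p = pressure \<Gamma> U; D = U $ 1; m = vector [U $ 2, U $ 3] :: real ^ 2
     in vector [D * v $ a,
                m $ 1 * v $ a + p * of_bool (a = 1),
                m $ 2 * v $ a + p * of_bool (a = 2),
                m $ a])"

definition entropy :: "real \<Rightarrow> real ^ 4 \<Rightarrow> real" where
  "entropy \<Gamma> U =
    (let s = ln (pressure \<Gamma> U) - \<Gamma> * ln (rest_density \<Gamma> U) in - (U $ 1) * s / (\<Gamma> - 1))"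

text \<open>The gradient with respect to the conserved variables; its value in closed form is
  \<open>entropy_variables_conserved\<close>.\<close>

definition entropy_variables :: "real \<Rightarrow> real ^ 4 \<Rightarrow> real ^ 4" where
  "entropy_variables \<Gamma> U = (THE V. GDERIV (entropy \<Gamma>) U :> V)"

definition potential :: "real ^ 4 \<Rightarrow> real" where
  "potential U = U $ 1"

definition flux_potential :: "real \<Rightarrow> 2 \<Rightarrow> real ^ 4 \<Rightarrow> real" where
  "flux_potential \<Gamma> a U = U $ 1 * velocity \<Gamma> U $ a"


section \<open>Geometry and weighted quantities\<close>

text \<open>\<open>\<alpha>\<close> is the lapse, \<open>\<beta>\<close> the shift, \<open>\<gamma>\<close> the spatial metric (lower indices) and \<open>w\<close> the weight.\<close>

definition positive_definite :: "real ^ 2 ^ 2 \<Rightarrow> bool" where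
  "positive_definite \<gamma> \<longleftrightarrow> (\<forall>x. x \<noteq> 0 \<longrightarrow> x \<bullet> (\<gamma> *v x) > 0)"

definition vol :: "real ^ 2 ^ 2 \<Rightarrow> real" where
  "vol \<gamma> = sqrt (det \<gamma>)"

text \<open>Entry \<open>frame \<gamma> $ a $ I\<close> is \<open>\<Theta>\<^bsub>aI\<^esub>\<close>, so the entry below the diagonal is \<open>\<Theta> $ 2 $ 1\<close>.\<close>

definition is_frame :: "real ^ 2 ^ 2 \<Rightarrow> real ^ 2 ^ 2 \<Rightarrow> bool" where
  "is_frame \<gamma> \<Theta> \<longleftrightarrow> \<Theta> $ 2 $ 1 = 0 \<and> (\<forall>a. \<Theta> $ a $ a > 0) \<and> transpose \<Theta> ** \<Theta> = matrix_inv \<gamma>"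

definition frame :: "real ^ 2 ^ 2 \<Rightarrow> real ^ 2 ^ 2" where
  "frame \<gamma> = (THE \<Theta>. is_frame \<gamma> \<Theta>)"

definition weighted_A :: "real \<Rightarrow> real ^ 2 ^ 2 \<Rightarrow> real \<Rightarrow> 2 \<Rightarrow> 2 \<Rightarrow> real" where
  "weighted_A \<alpha> \<gamma> w a I = w * (\<alpha> * vol \<gamma> * frame \<gamma> $ a $ I)"

definition weighted_C :: "real ^ 2 \<Rightarrow> real ^ 2 ^ 2 \<Rightarrow> real \<Rightarrow> 2 \<Rightarrow> real" where
  "weighted_C \<beta> \<gamma> w I = w * (vol \<gamma> * \<beta> $ I)"

definition weighted_state :: "real ^ 2 ^ 2 \<Rightarrow> real \<Rightarrow> real ^ 4 \<Rightarrow> real ^ 4" where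
  "weighted_state \<gamma> w U = (w * vol \<gamma>) *\<^sub>R U"

definition weighted_flux ::
    "real \<Rightarrow> real \<Rightarrow> real ^ 2 \<Rightarrow> real ^ 2 ^ 2 \<Rightarrow> real \<Rightarrow> 2 \<Rightarrow> real ^ 4 \<Rightarrow> real ^ 4" where
  "weighted_flux \<Gamma> \<alpha> \<beta> \<gamma> w I U =
    (\<Sum>a\<in>UNIV. weighted_A \<alpha> \<gamma> w a I *\<^sub>R flux \<Gamma> a U) - weighted_C \<beta> \<gamma> w I *\<^sub>R U"

definition weighted_potential ::
    "real \<Rightarrow> real \<Rightarrow> real ^ 2 \<Rightarrow> real ^ 2 ^ 2 \<Rightarrow> real \<Rightarrow> 2 \<Rightarrow> real ^ 4 \<Rightarrow> real" where
  "weighted_potential \<Gamma> \<alpha> \<beta> \<gamma> w I U =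
    (\<Sum>a\<in>UNIV. weighted_A \<alpha> \<gamma> w a I * flux_potential \<Gamma> a U) - weighted_C \<beta> \<gamma> w I * potential U"

definition normal_flux ::
    "real \<Rightarrow> real \<Rightarrow> real ^ 2 \<Rightarrow> real ^ 2 ^ 2 \<Rightarrow> real \<Rightarrow> real ^ 2 \<Rightarrow> real ^ 4 \<Rightarrow> real ^ 4" where
  "normal_flux \<Gamma> \<alpha> \<beta> \<gamma> w n U = (\<Sum>I\<in>UNIV. n $ I *\<^sub>R weighted_flux \<Gamma> \<alpha> \<beta> \<gamma> w I U)"

definition normal_potential ::
    "real \<Rightarrow> real \<Rightarrow> real ^ 2 \<Rightarrow> real ^ 2 ^ 2 \<Rightarrow> real \<Rightarrow> real ^ 2 \<Rightarrow> real ^ 4 \<Rightarrow> real" where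
  "normal_potential \<Gamma> \<alpha> \<beta> \<gamma> w n U = (\<Sum>I\<in>UNIV. n $ I * weighted_potential \<Gamma> \<alpha> \<beta> \<gamma> w I U)"

definition causal_speed :: "real \<Rightarrow> real ^ 2 \<Rightarrow> real ^ 2 ^ 2 \<Rightarrow> real ^ 2 \<Rightarrow> real" where
  "causal_speed \<alpha> \<beta> \<gamma> n =
    \<bar>\<Sum>I\<in>UNIV. \<beta> $ I * n $ I\<bar>
      + \<alpha> * sqrt (\<Sum>I\<in>UNIV. \<Sum>J\<in>UNIV. matrix_inv \<gamma> $ I $ J * n $ I * n $ J)"

definition llf_flux ::
    "real \<Rightarrow> real \<Rightarrow> real ^ 2 \<Rightarrow> real ^ 2 ^ 2 \<Rightarrow> real \<Rightarrow> real ^ 2 \<Rightarrow> real ^ 4 \<Rightarrow> real ^ 4 \<Rightarrow> real ^ 4" where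
  "llf_flux \<Gamma> \<alpha> \<beta> \<gamma> w n U\<^sub>m U\<^sub>p =
    (1 / 2) *\<^sub>R (normal_flux \<Gamma> \<alpha> \<beta> \<gamma> w n U\<^sub>m + normal_flux \<Gamma> \<alpha> \<beta> \<gamma> w n U\<^sub>p)
      - (causal_speed \<alpha> \<beta> \<gamma> n / 2) *\<^sub>R (weighted_state \<gamma> w U\<^sub>p - weighted_state \<gamma> w U\<^sub>m)"


section \<open>Well-definedness and closed forms\<close>

lemma vector_4 [simp]:
  "(vector [x, y, z, t] :: ('a::zero) ^ 4) $ 1 = x"
  "(vector [x, y, z, t] :: ('a::zero) ^ 4) $ 2 = y"
  "(vector [x, y, z, t] :: ('a::zero) ^ 4) $ 3 = z"
  "(vector [x, y, z, t] :: ('a::zero) ^ 4) $ 4 = t"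
  unfolding vector_def by simp_all

lemma norm_power2_2: "(norm (v :: real ^ 2))\<^sup>2 = (v $ 1)\<^sup>2 + (v $ 2)\<^sup>2"
  unfolding power2_norm_eq_inner inner_vec_def by (simp add: sum_2 power2_eq_square)

lemma lorentz_factor_props:
  assumes "norm v < 1"
  shows "lorentz_factor v > 0" "(lorentz_factor v)\<^sup>2 * (1 - (norm v)\<^sup>2) = 1"
proof -
  have "(norm v)\<^sup>2 < 1" using assms by (simp add: power_less_one_iff)
  then show "lorentz_factor v > 0" "(lorentz_factor v)\<^sup>2 * (1 - (norm v)\<^sup>2) = 1"
    by (simp_all add: lorentz_factor_def power_divide)
qed

lemma pressure_unique:
  fixes D E M G p q :: real
  assumes G: "G \<ge> 2" and D: "D > 0" and M: "M \<ge> 0"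
    and x: "E + p > 0" "M < (E + p)\<^sup>2" and y: "E + q > 0" "M < (E + q)\<^sup>2"
    and fp: "(E + p) - M / (E + p) = D * sqrt (1 - M / (E + p)\<^sup>2) + G * p"
    and fq: "(E + q) - M / (E + q) = D * sqrt (1 - M / (E + q)\<^sup>2) + G * q"
  shows "\<not> p < q"
proof
  assume less: "p < q"
  let ?x = "E + p" and ?y = "E + q"
  have "?x\<^sup>2 \<le> ?y\<^sup>2" using less x by (intro power_mono) auto
  then have "M / ?y\<^sup>2 \<le> M / ?x\<^sup>2" using M x y
    by (intro divide_left_mono mult_pos_pos zero_less_power)
  then have "sqrt (1 - M / ?x\<^sup>2) \<le> sqrt (1 - M / ?y\<^sup>2)" by simp
  then have s: "D * sqrt (1 - M / ?x\<^sup>2) \<le> D * sqrt (1 - M / ?y\<^sup>2)" using D by simp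
  have "?x * ?x \<le> ?x * ?y" using less x by (intro mult_left_mono) auto
  with x(2) have lt: "M < ?x * ?y" unfolding power2_eq_square by (rule less_le_trans)
  have "M / ?x - M / ?y = M / (?x * ?y) * (q - p)"
    using x y by (simp add: field_simps)
  also have "\<dots> < 1 * (q - p)"
    using lt x y less by (intro mult_strict_right_mono) auto
  finally have 1: "M / ?x - M / ?y < q - p" by simp
  have 2: "2 * (q - p) \<le> G * q - G * p"
    using mult_right_mono[OF G, of "q - p"] less by (simp add: algebra_simps)
  have lin: False if "a - b < q - p" "2 * (q - p) \<le> d - c" "e \<le> f" "E + p - a = e + c" "E + q - b = f + d"
    for a b c d e f :: real
    using that by argo
  show False using lin[OF 1 2 s fp fq] .
qed

lemma Gamma_ratio:
  assumes "1 < \<Gamma>" "\<Gamma> \<le> (2::real)"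
  shows "\<Gamma> / (\<Gamma> - 1) \<ge> 2"
  using assms by (simp add: field_simps)

lemma conserved_relations:
  assumes G: "1 < \<Gamma>" and phys: "physical \<rho> v p"
    and U: "U = conserved \<Gamma> \<rho> v p"
    and x_def: "x = U $ 4 + p" and M_def: "M = (U $ 2)\<^sup>2 + (U $ 3)\<^sup>2"
  shows "U $ 1 > 0" "x > 0" "M < x\<^sup>2"
    "x - M / x = U $ 1 * sqrt (1 - M / x\<^sup>2) + \<Gamma> / (\<Gamma> - 1) * p"
    "v $ 1 = U $ 2 / x" "v $ 2 = U $ 3 / x" "\<rho> = U $ 1 * sqrt (1 - M / x\<^sup>2)"
proof -
  define L where "L = lorentz_factor v"
  define h where "h = specific_enthalpy \<Gamma> \<rho> p"
  have pos: "\<rho> > 0" "p > 0" "norm v < 1" using phys by (auto simp: physical_def)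
  note L = lorentz_factor_props[OF pos(3), folded L_def]
  have v: "(norm v)\<^sup>2 < 1" using pos by (simp add: power_less_one_iff)
  have rh: "\<rho> * h = \<rho> + \<Gamma> / (\<Gamma> - 1) * p"
    using pos G by (simp add: h_def specific_enthalpy_def field_simps)
  have rhpos: "\<rho> * h > 0" unfolding rh using pos G by (intro add_pos_pos mult_pos_pos) auto
  have comp: "U $ 1 = \<rho> * L" "U $ 2 = x * v $ 1" "U $ 3 = x * v $ 2" "x = \<rho> * h * L\<^sup>2"
    using U x_def by (simp_all add: conserved_def Let_def L_def h_def)
  show D: "U $ 1 > 0" using comp pos L by simp
  show x: "x > 0" using comp(4) rhpos L by simp
  have M: "M = x\<^sup>2 * (norm v)\<^sup>2"
    unfolding M_def comp(2,3) norm_power2_2 by (simp add: power_mult_distrib algebra_simps)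
  show "M < x\<^sup>2" unfolding M using x v by simp
  have Mx: "M / x\<^sup>2 = (norm v)\<^sup>2" "M / x = x * (norm v)\<^sup>2"
    unfolding M using x by (simp_all add: power2_eq_square)
  have "L * sqrt (1 - (norm v)\<^sup>2) = 1"
    using v by (simp add: L_def lorentz_factor_def)
  then show rho: "\<rho> = U $ 1 * sqrt (1 - M / x\<^sup>2)"
    unfolding Mx comp(1) by (simp add: mult.assoc)
  have "x - M / x = \<rho> * h * (L\<^sup>2 * (1 - (norm v)\<^sup>2))"
    unfolding Mx(2) unfolding comp(4) by (simp add: algebra_simps)
  also have "\<dots> = \<rho> + \<Gamma> / (\<Gamma> - 1) * p" by (simp add: L rh)
  finally show "x - M / x = U $ 1 * sqrt (1 - M / x\<^sup>2) + \<Gamma> / (\<Gamma> - 1) * p"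
    using rho by simp
  show "v $ 1 = U $ 2 / x" "v $ 2 = U $ 3 / x" using comp(2,3) x by simp_all
qed

lemma conserved_inject:
  assumes G: "1 < \<Gamma>" "\<Gamma> \<le> 2"
    and P: "physical \<rho> v p" and Q: "physical \<rho>' v' p'"
    and eq: "conserved \<Gamma> \<rho> v p = conserved \<Gamma> \<rho>' v' p'"
  shows "\<rho> = \<rho>' \<and> v = v' \<and> p = p'"
proof -
  define U where "U = conserved \<Gamma> \<rho> v p"
  define M where "M = (U $ 2)\<^sup>2 + (U $ 3)\<^sup>2"
  have U': "U = conserved \<Gamma> \<rho>' v' p'" using eq U_def by simp
  note r = conserved_relations[OF G(1) P U_def refl M_def]
  note r' = conserved_relations[OF G(1) Q U' refl M_def]
  have M: "M \<ge> 0" by (simp add: M_def)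
  have "p = p'"
    using pressure_unique[OF Gamma_ratio[OF G] r(1) M r(2,3) r'(2,3) r(4) r'(4)]
      pressure_unique[OF Gamma_ratio[OF G] r(1) M r'(2,3) r(2,3) r'(4) r(4)] by simp
  moreover from this have "\<rho> = \<rho>'" "v $ 1 = v' $ 1" "v $ 2 = v' $ 2"
    using r(5-7) r'(5-7) by simp_all
  ultimately show ?thesis by (simp add: vec_eq_iff forall_2)
qed

lemma primitives_conserved:
  assumes "1 < \<Gamma>" "\<Gamma> \<le> 2" "physical \<rho> v p"
  shows "primitives \<Gamma> (conserved \<Gamma> \<rho> v p) = (\<rho>, v, p)"
  unfolding primitives_def
proof (rule the_equality)
  show "case (\<rho>, v, p) of (\<rho>', v', p') \<Rightarrow>
      physical \<rho>' v' p' \<and> conserved \<Gamma> \<rho> v p = conserved \<Gamma> \<rho>' v' p'"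
    using assms by simp
  show "y = (\<rho>, v, p)" if "case y of (\<rho>', v', p') \<Rightarrow>
      physical \<rho>' v' p' \<and> conserved \<Gamma> \<rho> v p = conserved \<Gamma> \<rho>' v' p'" for y
    using that conserved_inject[OF assms] by (cases y) auto
qed

lemma has_derivative_vector_4:
  fixes a b c d :: "'a::real_normed_vector \<Rightarrow> real"
  assumes "(a has_derivative a') F" "(b has_derivative b') F"
    "(c has_derivative c') F" "(d has_derivative d') F"
  shows "((\<lambda>x. vector [a x, b x, c x, d x] :: real ^ 4) has_derivative
          (\<lambda>h. vector [a' h, b' h, c' h, d' h])) F"
proof -
  have e: "(vector [p, q, r, s] :: real ^ 4)
      = p *\<^sub>R axis 1 1 + q *\<^sub>R axis 2 1 + r *\<^sub>R axis 3 1 + s *\<^sub>R axis 4 1" for p q r s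
    by (simp add: vec_eq_iff forall_4 axis_def)
  show ?thesis unfolding e
    by (intro has_derivative_add has_derivative_scaleR_left assms)
qed

text \<open>The proof packs the primitive state into a vector \<open>(\<rho>, v\<^sub>1, v\<^sub>2, p)\<close>, so that \<open>conserved\<close> becomes a
  self-map of \<open>real ^ 4\<close> to which the inverse function theorem applies.\<close>

lemma entropy_gradient_conserved:
  assumes G: "1 < \<Gamma>" "\<Gamma> \<le> 2" and phys: "physical \<rho> v p"
  defines "s \<equiv> ln p - \<Gamma> * ln \<rho>" and "\<zeta> \<equiv> \<rho> / p" and "L \<equiv> lorentz_factor v"
  shows "GDERIV (entropy \<Gamma>) (conserved \<Gamma> \<rho> v p) :>
    vector [(\<Gamma> - s) / (\<Gamma> - 1) + \<zeta>, \<zeta> * L * v $ 1, \<zeta> * L * v $ 2, - \<zeta> * L]"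
proof -
  define k where "k = \<Gamma> / (\<Gamma> - 1)"
  have k2: "k \<ge> 2" using Gamma_ratio[OF G] by (simp add: k_def)
  define vel :: "real ^ 4 \<Rightarrow> real ^ 2" where "vel x = vector [x $ 2, x $ 3]" for x
  define S where "S = {x :: real ^ 4. physical (x $ 1) (vel x) (x $ 4)}"
  define f where "f x = conserved \<Gamma> (x $ 1) (vel x) (x $ 4)" for x
  define g where "g U = (case primitives \<Gamma> U of (r, u, q) \<Rightarrow> (vector [r, u $ 1, u $ 2, q] :: real ^ 4))"
    for U
  define x0 :: "real ^ 4" where "x0 = vector [\<rho>, v $ 1, v $ 2, p]"
  have x0_nth: "x0 $ 1 = \<rho>" "x0 $ 2 = v $ 1" "x0 $ 3 = v $ 2" "x0 $ 4 = p"
    by (simp_all add: x0_def)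
  have vel0: "vel x0 = v" by (simp add: vel_def x0_nth vec_eq_iff forall_2)
  have x0: "x0 \<in> S" "f x0 = conserved \<Gamma> \<rho> v p"
    using phys vel0 by (simp_all add: S_def f_def) (simp_all add: x0_nth)
  have pos: "\<rho> > 0" "p > 0" "norm v < 1" using phys by (auto simp: physical_def)
  define \<nu> where "\<nu> = (v $ 1)\<^sup>2 + (v $ 2)\<^sup>2"
  have L: "L > 0" "L\<^sup>2 * (1 - \<nu>) = 1"
    using lorentz_factor_props[OF pos(3)] by (simp_all add: L_def norm_power2_2 \<nu>_def)
  have \<nu>: "0 \<le> \<nu>" "\<nu> < 1"
    using pos(3) by (simp_all add: \<nu>_def norm_power2_2[symmetric] power_less_one_iff)

  define lf where "lf x = 1 / sqrt (1 - ((x $ 2)\<^sup>2 + (x $ 3)\<^sup>2))" for x :: "real ^ 4"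
  have lf: "lorentz_factor (vel x) = lf x" for x
    by (simp add: lorentz_factor_def lf_def norm_power2_2 vel_def)
  have lf0: "lf x0 = L" using lf[of x0] by (simp add: vel0 L_def)
  define q where "q x = (x $ 1 + k * x $ 4) * (lf x)\<^sup>2" for x :: "real ^ 4"
  define F where "F x = (vector [x $ 1 * lf x, q x * x $ 2, q x * x $ 3, q x - x $ 4] :: real ^ 4)" for x
  have fF: "f x = F x" if "x \<in> S" for x
  proof -
    have "x $ 1 > 0" using that by (simp add: S_def physical_def)
    then have "x $ 1 * specific_enthalpy \<Gamma> (x $ 1) (x $ 4) = x $ 1 + k * x $ 4"
      using G by (simp add: specific_enthalpy_def k_def field_simps)
    then show ?thesis
      by (simp add: f_def F_def conserved_def Let_def lf q_def) (simp add: vel_def)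
  qed
  have S_alt: "S = {x. 0 < x $ 1} \<inter> {x. (x $ 2)\<^sup>2 + (x $ 3)\<^sup>2 < 1} \<inter> {x. 0 < x $ 4}"
  proof -
    have "norm u < 1 \<longleftrightarrow> (u $ 1)\<^sup>2 + (u $ 2)\<^sup>2 < 1" for u :: "real ^ 2"
      by (simp add: norm_power2_2[symmetric] power_less_one_iff)
    then show ?thesis by (auto simp: S_def physical_def vel_def)
  qed
  have "open S" unfolding S_alt
    by (intro open_Int open_Collect_less continuous_intros)
  have gf: "g (f x) = x" if "x \<in> S" for x
    using that primitives_conserved[OF G]
    by (simp add: S_def f_def g_def vel_def vec_eq_iff forall_4)
  have "continuous_on S F"
  proof -
    have c: "continuous_on S lf" unfolding lf_def
      by (intro continuous_intros) (auto simp: S_alt)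
    have cq: "continuous_on S q" unfolding q_def by (intro continuous_intros c)
    have e: "F x = (x $ 1 * lf x) *\<^sub>R axis 1 1 + (q x * x $ 2) *\<^sub>R axis 2 1
        + (q x * x $ 3) *\<^sub>R axis 3 1 + (q x - x $ 4) *\<^sub>R axis 4 1" for x
      by (simp add: F_def vec_eq_iff forall_4 axis_def)
    show ?thesis unfolding e by (intro continuous_intros c cq)
  qed
  then have contf: "continuous_on S f" by (simp add: fF cong: continuous_on_cong)

  define vd where "vd d = v $ 1 * d $ 2 + v $ 2 * d $ 3" for d :: "real ^ 4"
  define Q where "Q = (\<rho> + k * p) * L\<^sup>2"
  define D' where "D' d = d $ 1 * L + \<rho> * (L ^ 3 * vd d)" for d
  define Q' where "Q' d = (d $ 1 + k * d $ 4) * L\<^sup>2 + 2 * (\<rho> + k * p) * L * (L ^ 3 * vd d)" for d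
  define f' where "f' d = (vector [D' d, Q' d * v $ 1 + Q * d $ 2, Q' d * v $ 2 + Q * d $ 3, Q' d - d $ 4]
      :: real ^ 4)" for d
  have nth: "((\<lambda>x :: real ^ 4. x $ i) has_derivative (\<lambda>d. d $ i)) (at x0)" for i
    by (rule bounded_linear_imp_has_derivative) (rule bounded_linear_vec_nth)
  have lf': "(lf has_derivative (\<lambda>d. L ^ 3 * vd d)) (at x0)"
  proof -
    have w: "((\<lambda>x :: real ^ 4. 1 - ((x $ 2)\<^sup>2 + (x $ 3)\<^sup>2)) has_derivative (\<lambda>d. - 2 * vd d)) (at x0)"
      by (auto intro!: derivative_eq_intros nth simp: vd_def x0_nth algebra_simps)
    have "((\<lambda>y. 1 / sqrt y) has_real_derivative - (1 / 2) * L ^ 3) (at (1 - \<nu>))"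
    proof -
      have L': "L = inverse (sqrt (1 - \<nu>))"
        by (simp add: L_def lorentz_factor_def norm_power2_2 \<nu>_def inverse_eq_divide)
      have "((\<lambda>y. inverse (sqrt y)) has_real_derivative - (L * (L / 2) * L)) (at (1 - \<nu>))"
        unfolding L' using \<nu> by (intro DERIV_inverse' DERIV_real_sqrt) auto
      then show ?thesis by (simp add: inverse_eq_divide power3_eq_cube)
    qed
    then have r: "((\<lambda>y. 1 / sqrt y) has_real_derivative - (1 / 2) * L ^ 3)
        (at (1 - ((x0 $ 2)\<^sup>2 + (x0 $ 3)\<^sup>2)))"
      by (simp add: x0_nth \<nu>_def)
    show ?thesis unfolding lf_def
      using has_derivative_compose[OF w r[unfolded has_field_derivative_def]]
      by (rule has_derivative_eq_rhs) (simp add: fun_eq_iff)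
  qed
  have q': "(q has_derivative Q') (at x0)" unfolding q_def
    by (auto intro!: derivative_eq_intros nth lf' simp: fun_eq_iff Q'_def lf0 x0_nth algebra_simps power2_eq_square)
  have q0: "q x0 = Q" by (simp add: q_def Q_def lf0) (simp add: x0_nth)
  have F': "(F has_derivative f') (at x0)"
    unfolding F_def f'_def
    by (rule has_derivative_vector_4)
       (auto intro!: derivative_eq_intros nth lf' q' simp: fun_eq_iff D'_def lf0 q0 x0_nth algebra_simps)
  then have derf: "(f has_derivative f') (at x0)"
    by (rule has_derivative_transform_within_open[OF _ \<open>open S\<close> x0(1)]) (simp add: fF)

  have Qpos: "Q > 0" using k2 pos L by (auto simp: Q_def intro!: mult_pos_pos add_pos_pos)
  have lin: "linear f'" using derf by (rule has_derivative_linear)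
  have "inj f'"
  proof (subst linear_injective_0[OF lin], intro allI impI)
    fix d assume "f' d = 0"
    then have z: "D' d = 0" "Q' d * v $ 1 + Q * d $ 2 = 0" "Q' d * v $ 2 + Q * d $ 3 = 0" "Q' d = d $ 4"
      by (auto simp: f'_def vec_eq_iff forall_4)
    define t where "t = d $ 4"
    have "v $ 1 * (Q' d * v $ 1 + Q * d $ 2) + v $ 2 * (Q' d * v $ 2 + Q * d $ 3) = 0" using z by simp
    then have Qvd: "Q * vd d = - t * \<nu>"
      by (simp add: z(4) t_def vd_def \<nu>_def algebra_simps power2_eq_square)
    have "L * (d $ 1 + \<rho> * L\<^sup>2 * vd d) = 0"
      using z(1) by (simp add: D'_def algebra_simps power2_eq_square power3_eq_cube)
    then have d1: "d $ 1 = - \<rho> * L\<^sup>2 * vd d" using L by simp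
    have "Q' d = L\<^sup>2 * (d $ 1 + k * t + 2 * (Q * vd d))"
      by (simp add: Q'_def Q_def t_def algebra_simps power2_eq_square power3_eq_cube)
    then have t': "t = L\<^sup>2 * (d $ 1 + k * t - 2 * t * \<nu>)"
      unfolding z(4) Qvd by (simp add: t_def algebra_simps)
    have "(1 - \<nu>) * t = (L\<^sup>2 * (1 - \<nu>)) * (d $ 1 + k * t - 2 * t * \<nu>)"
      using arg_cong[OF t', of "\<lambda>y. (1 - \<nu>) * y"] by (simp add: mult_ac)
    then have "d $ 1 + t * (k - 1 - \<nu>) = 0" unfolding L(2) by (simp add: algebra_simps)
    then have "Q * (d $ 1 + t * (k - 1 - \<nu>)) = 0" by simp
    then have "- \<rho> * L\<^sup>2 * (Q * vd d) + Q * t * (k - 1 - \<nu>) = 0"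
      by (simp add: d1 algebra_simps)
    then have "t * (\<rho> * L\<^sup>2 * \<nu> + Q * (k - 1 - \<nu>)) = 0"
      unfolding Qvd by (simp add: algebra_simps)
    moreover have "\<rho> * L\<^sup>2 * \<nu> + Q * (k - 1 - \<nu>) > 0"
      using pos \<nu> k2 Qpos by (intro add_nonneg_pos mult_pos_pos mult_nonneg_nonneg) auto
    ultimately have t: "t = 0" by simp
    then have "vd d = 0" using Qvd Qpos by simp
    then have "d $ 1 = 0" "d $ 2 = 0" "d $ 3 = 0" "d $ 4 = 0"
      using d1 z t Qpos by (auto simp: t_def)
    then show "d = 0" by (simp add: vec_eq_iff forall_4)
  qed
  then have "surj f'" by (rule linear_injective_imp_surjective[OF lin _ refl])
  then obtain g' where g': "linear g'" "f' \<circ> g' = id"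
    using linear_surjective_right_inverse[OF lin] by blast
  have derg: "(g has_derivative g') (at (f x0))"
    by (rule has_derivative_inverse_strong[OF \<open>open S\<close> x0(1) contf gf derf g'(2)])

  define e where "e x = - (x $ 1 * lf x) * (ln (x $ 4) - \<Gamma> * ln (x $ 1)) / (\<Gamma> - 1)" for x :: "real ^ 4"
  define e' where "e' d = (D' d * s + \<rho> * L * (d $ 4 / p - \<Gamma> * (d $ 1 / \<rho>))) * (- 1 / (\<Gamma> - 1))" for d :: "real ^ 4"
  let ?V = "vector [(\<Gamma> - s) / (\<Gamma> - 1) + \<zeta>, \<zeta> * L * v $ 1, \<zeta> * L * v $ 2, - \<zeta> * L] :: real ^ 4"
  have dere: "(e has_derivative e') (at x0)"
  proof -
    have D: "((\<lambda>x. x $ 1 * lf x) has_derivative D') (at x0)"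
      by (auto intro!: derivative_eq_intros nth lf' simp: fun_eq_iff D'_def lf0 x0_nth)
    have s': "((\<lambda>x. ln (x $ 4) - \<Gamma> * ln (x $ 1)) has_derivative
        (\<lambda>d. d $ 4 / p - \<Gamma> * (d $ 1 / \<rho>))) (at x0)"
      using pos by (auto intro!: derivative_eq_intros nth simp: fun_eq_iff x0_nth field_simps)
    have "((\<lambda>x. (x $ 1 * lf x) * (ln (x $ 4) - \<Gamma> * ln (x $ 1)) * (- 1 / (\<Gamma> - 1))) has_derivative e') (at x0)"
      by (rule has_derivative_eq_rhs[OF has_derivative_mult_left[OF has_derivative_mult[OF D s']]])
         (simp only: fun_eq_iff e'_def x0_nth lf0 s_def add.commute, simp)
    moreover have "e = (\<lambda>x. (x $ 1 * lf x) * (ln (x $ 4) - \<Gamma> * ln (x $ 1)) * (- 1 / (\<Gamma> - 1)))"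
      by (simp add: e_def fun_eq_iff)
    ultimately show ?thesis by simp
  qed
  have e'V: "e' d = f' d \<bullet> ?V" for d
  proof -
    have 1: "v $ 1 * (Q' d * v $ 1 + Q * d $ 2) + v $ 2 * (Q' d * v $ 2 + Q * d $ 3) - (Q' d - d $ 4)
      = - (Q' d * (1 - \<nu>)) + Q * vd d + d $ 4"
      by (simp add: \<nu>_def vd_def algebra_simps power2_eq_square)
    have "Q' d * (1 - \<nu>) = (L\<^sup>2 * (1 - \<nu>)) * (d $ 1 + k * d $ 4 + 2 * (\<rho> + k * p) * L\<^sup>2 * vd d)"
      by (simp add: Q'_def algebra_simps power2_eq_square power3_eq_cube)
    then have 2: "Q' d * (1 - \<nu>) = d $ 1 + k * d $ 4 + 2 * Q * vd d"
      unfolding L(2) by (simp add: Q_def algebra_simps)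
    have 3: "k - 1 = 1 / (\<Gamma> - 1)" using G by (simp add: k_def field_simps)
    have 4: "(\<Gamma> - s) / (\<Gamma> - 1) = k - s * (k - 1)" unfolding 3 by (simp add: k_def diff_divide_distrib)
    have 5: "\<Gamma> * (k - 1) = k" unfolding 3 by (simp add: k_def)
    have 6: "- 1 / (\<Gamma> - 1) = - (k - 1)" unfolding 3 by simp
    have "f' d \<bullet> ?V = D' d * ((\<Gamma> - s) / (\<Gamma> - 1) + \<zeta>) + \<zeta> * L *
      (v $ 1 * (Q' d * v $ 1 + Q * d $ 2) + v $ 2 * (Q' d * v $ 2 + Q * d $ 3) - (Q' d - d $ 4))"
      by (simp add: f'_def inner_vec_def sum_4 algebra_simps)
    also have "\<dots> = D' d * (k - s * (k - 1) + \<zeta>) + \<zeta> * L * (- d $ 1 - (k - 1) * d $ 4 - Q * vd d)"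
      unfolding 1 2 4 by (simp add: algebra_simps)
    also have "\<dots> = - (D' d * s) * (k - 1) - \<rho> * L * (d $ 4 / p) * (k - 1) + k * L * d $ 1"
      using pos by (simp add: D'_def Q_def \<zeta>_def field_simps power2_eq_square power3_eq_cube)
    also have "\<dots> = e' d"
    proof -
      have "e' d = - (D' d * s) * (k - 1) - \<rho> * L * (d $ 4 / p) * (k - 1)
          + (\<Gamma> * (k - 1)) * L * (\<rho> * (d $ 1 / \<rho>))"
        unfolding e'_def 6 by (simp only: ring_distribs mult_minus_left mult_minus_right
            minus_add_distrib minus_diff_eq mult_1_right mult_1_left mult_ac add_ac diff_conv_add_uminus minus_minus)
      then show ?thesis using pos unfolding 5 by simp
    qed
    finally show ?thesis ..
  qed
  have "open (f ` S)"
  proof (rule invariance_of_domain[OF contf \<open>open S\<close>])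
    show "inj_on f S" by (metis gf inj_onI)
  qed
  have ent: "entropy \<Gamma> U = e (g U)" if U: "U \<in> f ` S" for U
  proof -
    obtain x where x: "x \<in> S" "U = f x" using U by blast
    have "primitives \<Gamma> U = (x $ 1, vel x, x $ 4)"
      using x primitives_conserved[OF G] by (simp add: S_def f_def)
    then have "rest_density \<Gamma> U = x $ 1" "pressure \<Gamma> U = x $ 4"
      by (simp_all add: rest_density_def pressure_def)
    moreover have "U $ 1 = x $ 1 * lf x" using x fF by (simp add: F_def)
    ultimately show ?thesis using x gf by (simp add: entropy_def Let_def e_def)
  qed
  have "((\<lambda>U. e (g U)) has_derivative (\<lambda>u. e' (g' u))) (at (f x0))"
    by (rule has_derivative_compose[OF derg]) (simp add: gf x0(1) dere)
  then have "(entropy \<Gamma> has_derivative (\<lambda>u. e' (g' u))) (at (f x0))"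
    by (rule has_derivative_transform_within_open[OF _ \<open>open (f ` S)\<close>]) (use x0(1) ent in auto)
  moreover have "e' (g' u) = u \<bullet> ?V" for u
    unfolding e'V using fun_cong[OF g'(2), of u] by simp
  ultimately show ?thesis by (simp add: gderiv_def x0)
qed

lemma entropy_variables_conserved:
  assumes "1 < \<Gamma>" "\<Gamma> \<le> 2" "physical \<rho> v p"
  defines "s \<equiv> ln p - \<Gamma> * ln \<rho>" and "\<zeta> \<equiv> \<rho> / p" and "L \<equiv> lorentz_factor v"
  shows "entropy_variables \<Gamma> (conserved \<Gamma> \<rho> v p) =
    vector [(\<Gamma> - s) / (\<Gamma> - 1) + \<zeta>, \<zeta> * L * v $ 1, \<zeta> * L * v $ 2, - \<zeta> * L]"
  unfolding entropy_variables_def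
proof (rule the_equality)
  show der: "GDERIV (entropy \<Gamma>) (conserved \<Gamma> \<rho> v p) :>
      vector [(\<Gamma> - s) / (\<Gamma> - 1) + \<zeta>, \<zeta> * L * v $ 1, \<zeta> * L * v $ 2, - \<zeta> * L]"
    unfolding s_def \<zeta>_def L_def using assms(1-3) by (rule entropy_gradient_conserved)
  show "V = vector [(\<Gamma> - s) / (\<Gamma> - 1) + \<zeta>, \<zeta> * L * v $ 1, \<zeta> * L * v $ 2, - \<zeta> * L]"
    if "GDERIV (entropy \<Gamma>) (conserved \<Gamma> \<rho> v p) :> V" for V
    using has_derivative_unique[OF that[unfolded gderiv_def] der[unfolded gderiv_def]]
    by (metis vector_eq_ldot)
qed

lemma is_frame_frame:
  assumes sym: "transpose \<gamma> = \<gamma>" and pd: "positive_definite \<gamma>"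
  shows "is_frame \<gamma> (frame \<gamma>)" "is_frame \<gamma> \<Theta> \<Longrightarrow> \<Theta> = frame \<gamma>"
proof -
  define K where "K = matrix_inv \<gamma>"
  have "\<gamma> *v x = 0 \<Longrightarrow> x = 0" for x
    using pd unfolding positive_definite_def by force
  then have inv: "invertible \<gamma>"
    by (metis invertible_left_inverse matrix_left_invertible_ker)
  have mul: "\<gamma> ** K = mat 1" "K ** \<gamma> = mat 1"
    using someI_ex[OF inv[unfolded invertible_def]] by (simp_all add: K_def matrix_inv_def)
  have "transpose K ** \<gamma> = mat 1"
    using arg_cong[OF mul(1), of transpose] sym by (simp add: matrix_transpose_mul)
  then have symK: "transpose K = K"
    by (metis mul(1) matrix_mul_assoc matrix_mul_lid matrix_mul_rid)
  have pdK: "x \<bullet> (K *v x) > 0" if "x \<noteq> 0" for x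
  proof -
    have x: "x = \<gamma> *v (K *v x)" by (simp add: matrix_vector_mul_assoc mul)
    then have "K *v x \<noteq> 0" using that by force
    then have "(K *v x) \<bullet> (\<gamma> *v (K *v x)) > 0" using pd by (simp add: positive_definite_def)
    then show ?thesis using x by (metis inner_commute)
  qed
  define a b c where "a = K $ 1 $ 1" and "b = K $ 1 $ 2" and "c = K $ 2 $ 2"
  have b: "K $ 2 $ 1 = b" using arg_cong[OF symK, of "\<lambda>M. M $ 1 $ 2"] by (simp add: transpose_def b_def)
  have quad: "x \<bullet> (K *v x) = a * (x $ 1)\<^sup>2 + 2 * b * x $ 1 * x $ 2 + c * (x $ 2)\<^sup>2" for x
    by (simp add: inner_vec_def matrix_vector_mult_def sum_2 a_def b c_def b_def[symmetric]
        power2_eq_square algebra_simps)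
  have a: "a > 0" using pdK[of "vector [1, 0]"] by (simp add: quad vec_eq_iff forall_2)
  have "a * (a * c - b\<^sup>2) > 0"
    using pdK[of "vector [- b, a]"] a
    by (simp add: quad vec_eq_iff forall_2 power2_eq_square algebra_simps)
  then have det: "c - (b / sqrt a)\<^sup>2 > 0"
    using a by (simp add: zero_less_mult_iff power_divide field_simps)
  have iff: "is_frame \<gamma> T \<longleftrightarrow> T = vector [vector [sqrt a, b / sqrt a],
      vector [0, sqrt (c - (b / sqrt a)\<^sup>2)]]" (is "_ \<longleftrightarrow> T = ?T") for T
  proof -
    have "is_frame \<gamma> T \<longleftrightarrow> T $ 2 $ 1 = 0 \<and> T $ 1 $ 1 > 0 \<and> T $ 2 $ 2 > 0 \<and> (T $ 1 $ 1)\<^sup>2 = a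
        \<and> T $ 1 $ 1 * T $ 1 $ 2 = b \<and> (T $ 1 $ 2)\<^sup>2 + (T $ 2 $ 2)\<^sup>2 = c"
      unfolding is_frame_def K_def[symmetric]
      by (auto simp: vec_eq_iff forall_2 matrix_matrix_mult_def transpose_def sum_2 a_def b
          c_def b_def[symmetric] power2_eq_square algebra_simps)
    also have "\<dots> \<longleftrightarrow> T $ 1 $ 1 = sqrt a \<and> T $ 1 $ 2 = b / sqrt a \<and> T $ 2 $ 1 = 0
        \<and> T $ 2 $ 2 = sqrt (c - (b / sqrt a)\<^sup>2)"
    proof safe
      assume "0 < T $ 1 $ 1" "0 < T $ 2 $ 2" and e: "a = (T $ 1 $ 1)\<^sup>2" "b = T $ 1 $ 1 * T $ 1 $ 2"
        "c = (T $ 1 $ 2)\<^sup>2 + (T $ 2 $ 2)\<^sup>2"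
      then show "T $ 1 $ 1 = sqrt ((T $ 1 $ 1)\<^sup>2)"
        "T $ 1 $ 2 = T $ 1 $ 1 * T $ 1 $ 2 / sqrt ((T $ 1 $ 1)\<^sup>2)"
        "T $ 2 $ 2 = sqrt ((T $ 1 $ 2)\<^sup>2 + (T $ 2 $ 2)\<^sup>2
          - (T $ 1 $ 1 * T $ 1 $ 2 / sqrt ((T $ 1 $ 1)\<^sup>2))\<^sup>2)"
        by simp_all
    qed (use a det in auto)
    also have "\<dots> \<longleftrightarrow> T = ?T" by (simp add: vec_eq_iff forall_2)
    finally show ?thesis .
  qed
  then show "is_frame \<gamma> (frame \<gamma>)" "is_frame \<gamma> \<Theta> \<Longrightarrow> \<Theta> = frame \<gamma>"
    unfolding frame_def by (auto intro: theI2 the_equality[symmetric])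
qed

end

theory Submission
  imports Defs
begin

text \<open>The frame turns the face normal \<open>n\<close> into \<open>\<Theta> n = |\<Theta> n| \<nu>\<close> with a unit vector \<open>\<nu>\<close>, and
  \<open>|\<Theta> n|\<^sup>2 = \<gamma>\<^bsup>IJ\<^esup> n\<^sub>I n\<^sub>J\<close>. With \<open>c = \<alpha> |\<Theta> n|\<close>, \<open>b = \<beta>\<^bsup>I\<^esup> n\<^sub>I\<close> and \<open>F\<close>, \<open>\<psi>\<close> the flux and its potential
  in the direction \<open>\<nu>\<close>, the normal flux is a positive multiple of \<open>c F - b U\<close> and the dissipation
  speed is \<open>c + |b|\<close>. The claim thus splits into a flat Lax-Friedrichs estimate of speed \<open>1\<close>,
  weighted with \<open>c\<close>, and an upwind estimate for the advection by the shift, weighted with \<open>|b|\<close>.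

  Up to the factor \<open>1/2\<close>, the flat Lax-Friedrichs flux is \<open>U + F\<close> at the left state minus \<open>U - F\<close> at
  the right state. As functions of the entropy variables \<open>V\<close>, the combinations \<open>\<Phi> + \<psi>\<close> and
  \<open>\<Phi> - \<psi>\<close> have the gradients \<open>U + F\<close> and \<open>U - F\<close>, so the flat estimate is the sum of their
  tangent inequalities at these states. Half the sum of the two functions is \<open>\<Phi>\<close>, with gradient
  \<open>U\<close>, and its tangent at the upwind state settles the shift. Since \<open>\<nu>\<close> may be
  replaced by \<open>-\<nu>\<close>, all that remains is that \<open>\<Phi> + \<psi> = \<rho> L (1 + v \<bullet> \<nu>)\<close> lies above its
  tangents in \<open>V\<close> (\<open>characteristic_potential_tangent\<close>).

  This function is even log-convex. Put \<open>k = \<Gamma> / (\<Gamma> - 1)\<close> and let \<open>a = L (1 + v \<bullet> \<nu>)\<close>, the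
  product of the four-velocity with a null covector. The logarithm is \<open>V\<^sub>1 - k - \<zeta> - k ln \<zeta> + ln (\<zeta> a)\<close>,
  where \<open>\<zeta>\<close> is the Minkowski length of the timelike vector \<open>(\<zeta> L, \<zeta> L v)\<close> and \<open>\<zeta> a\<close> is linear in that
  vector. The length is concave, by the reversed Cauchy-Schwarz inequality, so \<open>- \<zeta>\<close> and \<open>- ln \<zeta>\<close> are convex.
  Two copies of \<open>- ln \<zeta>\<close> absorb the concave term \<open>ln (\<zeta> a)\<close>, because \<open>\<zeta>\<^sup>2 / (\<zeta> a)\<close> is concave as well.
  Two copies are available exactly when \<open>k \<ge> 2\<close>, that is \<open>\<Gamma> \<le> 2\<close>.\<close>

section \<open>Log-convexity of the characteristic potentials\<close>

text \<open>For \<open>|v|, |v'| < 1\<close>, division by \<open>(1 - |v|\<^sup>2) (1 - |v'|\<^sup>2)\<close> turns this into a statement on four-velocities \<open>u\<close>, \<open>u'\<close>: the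
  vector \<open>(u' \<bullet> l) u - (u \<bullet> l) u'\<close> is orthogonal to the null covector \<open>l = (1, \<nu>)\<close>, hence not
  timelike. In the present form it is Cauchy-Schwarz for the spatial part of that vector and \<open>\<nu>\<close>.\<close>

lemma null_orthogonal_not_timelike:
  fixes v v' \<nu> :: "'a::real_inner"
  assumes "norm \<nu> = 1"
  defines "c \<equiv> 1 + v \<bullet> \<nu>" and "c' \<equiv> 1 + v' \<bullet> \<nu>"
  shows "c'\<^sup>2 * (1 - (norm v)\<^sup>2) + c\<^sup>2 * (1 - (norm v')\<^sup>2) \<le> 2 * c * c' * (1 - v \<bullet> v')"
proof -
  let ?d = "c' *\<^sub>R v - c *\<^sub>R v'"
  have "?d \<bullet> \<nu> = c - c'"
    by (simp add: c_def c'_def inner_diff_left algebra_simps)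
  moreover have "(?d \<bullet> \<nu>)\<^sup>2 \<le> (norm ?d)\<^sup>2"
    using Cauchy_Schwarz_ineq2[of ?d \<nu>] assms(1) by (simp add: abs_le_square_iff[symmetric])
  ultimately have "(c - c')\<^sup>2 \<le> (norm ?d)\<^sup>2" by simp
  also have "\<dots> = c'\<^sup>2 * (norm v)\<^sup>2 + c\<^sup>2 * (norm v')\<^sup>2 - 2 * c * c' * (v \<bullet> v')"
    unfolding power2_norm_eq_inner
    by (simp add: inner_diff_left inner_diff_right inner_commute power2_eq_square algebra_simps)
  finally show ?thesis by (simp add: power2_eq_square algebra_simps)
qed

text \<open>The pairing of the four-velocity with the null covector \<open>(1, \<nu>)\<close>.\<close>

definition null_factor :: "real ^ 2 \<Rightarrow> real ^ 2 \<Rightarrow> real" where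
  "null_factor \<nu> v = lorentz_factor v * (1 + v \<bullet> \<nu>)"

text \<open>The Lorentz factor of one velocity in the rest frame of the other.\<close>

definition relative_lorentz :: "real ^ 2 \<Rightarrow> real ^ 2 \<Rightarrow> real" where
  "relative_lorentz v v' = lorentz_factor v * lorentz_factor v' * (1 - v \<bullet> v')"

lemma null_factor_pos:
  assumes "norm \<nu> = 1" "norm v < 1"
  shows "null_factor \<nu> v > 0"
proof -
  have "\<bar>v \<bullet> \<nu>\<bar> < 1" using Cauchy_Schwarz_ineq2[of v \<nu>] assms by simp
  then show ?thesis
    unfolding null_factor_def using lorentz_factor_props(1)[OF assms(2)] by (intro mult_pos_pos) auto
qed

lemma null_factor_relative_lorentz:
  assumes "norm \<nu> = 1" "norm v < 1" "norm v' < 1"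
  shows "(null_factor \<nu> v)\<^sup>2 + (null_factor \<nu> v')\<^sup>2
    \<le> 2 * null_factor \<nu> v * null_factor \<nu> v' * relative_lorentz v v'"
proof -
  let ?L = "lorentz_factor v" and ?L' = "lorentz_factor v'"
  let ?c = "1 + v \<bullet> \<nu>" and ?c' = "1 + v' \<bullet> \<nu>"
  note L = lorentz_factor_props(2)[OF assms(2)] and L' = lorentz_factor_props(2)[OF assms(3)]
  have "(null_factor \<nu> v)\<^sup>2 + (null_factor \<nu> v')\<^sup>2
      = ?L\<^sup>2 * ?c\<^sup>2 * (?L'\<^sup>2 * (1 - (norm v')\<^sup>2)) + ?L'\<^sup>2 * ?c'\<^sup>2 * (?L\<^sup>2 * (1 - (norm v)\<^sup>2))"
    unfolding L L' by (simp add: null_factor_def power_mult_distrib)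
  also have "\<dots> = (?L\<^sup>2 * ?L'\<^sup>2) * (?c'\<^sup>2 * (1 - (norm v)\<^sup>2) + ?c\<^sup>2 * (1 - (norm v')\<^sup>2))"
    by (simp only: distrib_left mult_ac add_ac)
  also have "\<dots> \<le> (?L\<^sup>2 * ?L'\<^sup>2) * (2 * ?c * ?c' * (1 - v \<bullet> v'))"
    by (intro mult_left_mono null_orthogonal_not_timelike assms) auto
  finally show ?thesis
    by (simp add: null_factor_def relative_lorentz_def power2_eq_square mult_ac)
qed

text \<open>The tangent inequality in terms of Lorentz scalars: \<open>\<zeta>' g\<close> is the value at the second state
  of the tangent at the first state to the Minkowski length, which lies above \<open>\<zeta>'\<close> since \<open>g \<ge> 1\<close>, while \<open>\<zeta> a\<close> is linear. The factor
  of \<open>\<rho> a\<close> on the left is the tangent increment of \<open>ln (\<rho> a)\<close>. The two uses of \<open>ln x \<le> x - 1\<close>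
  for \<open>t / y\<close> and \<open>t\<close> give the convexity of \<open>- ln (\<zeta>\<^sup>2 / (\<zeta> a))\<close> and of the remaining
  \<open>k - 2\<close> copies of \<open>- ln \<zeta>\<close>; the use for \<open>\<rho>' a' / (\<rho> a)\<close> passes from the logarithm to the
  function itself.\<close>

lemma log_convex_tangent:
  fixes k \<zeta> \<zeta>' a a' g V V' \<rho> \<rho>' :: real
  assumes k: "k \<ge> 2" and pos: "\<zeta> > 0" "\<zeta>' > 0" "a > 0" "a' > 0" "\<rho> > 0" "\<rho>' > 0"
    and g: "a\<^sup>2 + a'\<^sup>2 \<le> 2 * a * a' * g"
    and \<rho>: "ln \<rho> = V - k - \<zeta> - (k - 1) * ln \<zeta>"
    and \<rho>': "ln \<rho>' = V' - k - \<zeta>' - (k - 1) * ln \<zeta>'"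
  shows "\<rho> * a * (V' - V - (1 + k / \<zeta>) * (\<zeta>' * g - \<zeta>) + (\<zeta>' * a' / (\<zeta> * a) - 1)) \<le> \<rho>' * a' - \<rho> * a"
proof -
  define t y where "t = \<zeta>' / \<zeta>" and "y = a' / a"
  have t: "t > 0" and y: "y > 0" using pos by (auto simp: t_def y_def)
  have gy: "1 + y\<^sup>2 \<le> 2 * g * y"
  proof -
    have "a' = a * y" using pos by (simp add: y_def)
    then have "a\<^sup>2 * (1 + y\<^sup>2) \<le> a\<^sup>2 * (2 * g * y)"
      using g by (simp add: power2_eq_square algebra_simps)
    then show ?thesis using pos by simp
  qed
  have "2 * y \<le> 1 + y\<^sup>2" using zero_le_power2[of "1 - y"] by (simp add: power2_eq_square algebra_simps)
  then have "y * 1 \<le> y * g" using gy by (simp add: algebra_simps)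
  then have g1: "1 \<le> g" using y by simp
  have 1: "\<zeta>' \<le> \<zeta>' * g" "t \<le> t * g" using g1 pos t by auto
  have "t / y \<le> 2 * t * g - t * y"
    using mult_left_mono[OF gy, of t] t y by (simp add: power2_eq_square field_simps)
  then have 2: "ln t - ln y \<le> 2 * (t * g) - t * y - 1"
    using ln_le_minus_one[of "t / y"] t y by (simp add: ln_div)
  have "ln t \<le> t * g - 1" using ln_le_minus_one[OF t] 1 by simp
  then have 3: "(k - 2) * ln t \<le> (k - 2) * (t * g - 1)" using k by (intro mult_left_mono) auto
  have "V' - V - (1 + k / \<zeta>) * (\<zeta>' * g - \<zeta>) + (\<zeta>' * a' / (\<zeta> * a) - 1)
      = V' - V - (\<zeta>' * g - \<zeta>) - k * (t * g - 1) + (t * y - 1)"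
    using pos by (simp add: t_def y_def field_simps)
  also have "\<dots> \<le> V' - V - (\<zeta>' - \<zeta>) - (k - 1) * ln t + ln y"
    using 1 2 3 by (simp add: algebra_simps)
  also have "\<dots> = ln (\<rho>' * a' / (\<rho> * a))"
    using pos \<rho> \<rho>' by (simp add: t_def y_def ln_div ln_mult algebra_simps)
  also have "\<dots> \<le> \<rho>' * a' / (\<rho> * a) - 1" using pos by (intro ln_le_minus_one) simp
  finally have "\<rho> * a * (V' - V - (1 + k / \<zeta>) * (\<zeta>' * g - \<zeta>) + (\<zeta>' * a' / (\<zeta> * a) - 1))
      \<le> \<rho> * a * (\<rho>' * a' / (\<rho> * a) - 1)"
    using pos by (intro mult_left_mono) auto
  also have "\<dots> = \<rho>' * a' - \<rho> * a" using pos by (simp add: field_simps)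
  finally show ?thesis .
qed

definition directional_flux :: "real \<Rightarrow> real ^ 2 \<Rightarrow> real ^ 4 \<Rightarrow> real ^ 4" where
  "directional_flux \<Gamma> \<nu> U = (\<Sum>a\<in>UNIV. \<nu> $ a *\<^sub>R flux \<Gamma> a U)"

definition directional_potential :: "real \<Rightarrow> real ^ 2 \<Rightarrow> real ^ 4 \<Rightarrow> real" where
  "directional_potential \<Gamma> \<nu> U = (\<Sum>a\<in>UNIV. \<nu> $ a * flux_potential \<Gamma> a U)"

lemma inner_2: "(x :: real ^ 2) \<bullet> y = x $ 1 * y $ 1 + x $ 2 * y $ 2"
  by (simp add: inner_vec_def sum_2)

lemma directional_potential_conserved:
  assumes "1 < \<Gamma>" "\<Gamma> \<le> 2" "physical \<rho> v p"
  shows "potential (conserved \<Gamma> \<rho> v p) + directional_potential \<Gamma> \<nu> (conserved \<Gamma> \<rho> v p)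
    = \<rho> * null_factor \<nu> v"
proof -
  have "velocity \<Gamma> (conserved \<Gamma> \<rho> v p) = v"
    by (simp add: velocity_def primitives_conserved[OF assms])
  moreover have "conserved \<Gamma> \<rho> v p $ 1 = \<rho> * lorentz_factor v"
    by (simp add: conserved_def Let_def)
  ultimately show ?thesis
    by (simp add: potential_def directional_potential_def flux_potential_def sum_2
        null_factor_def inner_2 algebra_simps)
qed

lemma ln_density_entropy_variables:
  assumes G: "1 < \<Gamma>" "\<Gamma> \<le> 2" and P: "physical \<rho> v p"
  defines "k \<equiv> \<Gamma> / (\<Gamma> - 1)" and "\<zeta> \<equiv> \<rho> / p"
  shows "ln \<rho> = entropy_variables \<Gamma> (conserved \<Gamma> \<rho> v p) $ 1 - k - \<zeta> - (k - 1) * ln \<zeta>"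
proof -
  have pos: "\<rho> > 0" "p > 0" using P by (auto simp: physical_def)
  have "(\<Gamma> - (ln p - \<Gamma> * ln \<rho>)) / (\<Gamma> - 1) = k + (k - 1) * ln \<zeta> + ln \<rho>"
  proof -
    define i where "i = 1 / (\<Gamma> - 1)"
    have "i * (\<Gamma> - 1) = 1" using G by (simp add: i_def)
    then have i: "i * \<Gamma> = 1 + i" by (simp add: algebra_simps)
    have "(\<Gamma> - (ln p - \<Gamma> * ln \<rho>)) / (\<Gamma> - 1) = i * \<Gamma> * (1 + ln \<rho>) - i * ln p"
      by (simp add: i_def algebra_simps diff_divide_distrib add_divide_distrib)
    moreover have "k = 1 + i" using i by (simp add: k_def i_def)
    ultimately show ?thesis using pos unfolding i by (simp add: \<zeta>_def ln_div algebra_simps)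
  qed
  then show ?thesis
    unfolding entropy_variables_conserved[OF G P] by (simp add: \<zeta>_def)
qed

text \<open>The flux terms pair with the entropy variables in Lorentz scalars only, which reduces the
  tangent inequality to \<open>log_convex_tangent\<close>.\<close>

lemma characteristic_pairing:
  assumes G: "1 < \<Gamma>" "\<Gamma> \<le> 2" and P: "physical \<rho> v p" and P': "physical \<rho>' v' p'" and "norm \<nu> = 1"
  defines "U \<equiv> conserved \<Gamma> \<rho> v p" and "U' \<equiv> conserved \<Gamma> \<rho>' v' p'"
    and "\<zeta> \<equiv> \<rho> / p" and "\<zeta>' \<equiv> \<rho>' / p'" and "k \<equiv> \<Gamma> / (\<Gamma> - 1)"
    and "a \<equiv> null_factor \<nu> v" and "a' \<equiv> null_factor \<nu> v'"
  shows "(U + directional_flux \<Gamma> \<nu> U) \<bullet> (entropy_variables \<Gamma> U' - entropy_variables \<Gamma> U)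
    = \<rho> * a * (entropy_variables \<Gamma> U' $ 1 - entropy_variables \<Gamma> U $ 1
        - (1 + k / \<zeta>) * (\<zeta>' * relative_lorentz v v' - \<zeta>) + (\<zeta>' * a' / (\<zeta> * a) - 1))"
proof -
  define L L' where "L = lorentz_factor v" and "L' = lorentz_factor v'"
  define h where "h = specific_enthalpy \<Gamma> \<rho> p"
  define Q where "Q = \<rho> * h * L\<^sup>2"
  define V V' where "V = entropy_variables \<Gamma> U" and "V' = entropy_variables \<Gamma> U'"
  have pos: "\<rho> > 0" "p > 0" "norm v < 1" using P by (auto simp: physical_def)
  have \<zeta>: "\<zeta> > 0" "p * \<zeta> = \<rho>" using pos by (auto simp: \<zeta>_def)
  have a: "a > 0" unfolding a_def using assms(5) pos(3) by (rule null_factor_pos)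
  have h: "h = 1 + k / \<zeta>" using G pos by (simp add: h_def k_def \<zeta>_def specific_enthalpy_def)
  \<comment> \<open>the increment of the timelike part \<open>(q, u) = (\<zeta> L, \<zeta> L v)\<close> of the entropy variables\<close>
  define dq where "dq = \<zeta>' * L' - \<zeta> * L"
  define du where "du = (\<zeta>' * L') *\<^sub>R v' - (\<zeta> * L) *\<^sub>R v"
  have V: "V $ 2 = \<zeta> * L * v $ 1" "V $ 3 = \<zeta> * L * v $ 2" "V $ 4 = - \<zeta> * L"
    by (simp_all add: V_def U_def entropy_variables_conserved[OF G P] \<zeta>_def L_def)
  have V': "V' $ 2 = \<zeta>' * L' * v' $ 1" "V' $ 3 = \<zeta>' * L' * v' $ 2" "V' $ 4 = - \<zeta>' * L'"
    by (simp_all add: V'_def U'_def entropy_variables_conserved[OF G P'] \<zeta>'_def L'_def)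
  have dV: "(V' - V) $ 2 = du $ 1" "(V' - V) $ 3 = du $ 2" "(V' - V) $ 4 = - dq"
    by (simp_all add: V V' du_def dq_def)
  have U: "U $ 1 = \<rho> * L" "U $ 2 = Q * v $ 1" "U $ 3 = Q * v $ 2" "U $ 4 = Q - p"
    by (simp_all add: U_def conserved_def Let_def L_def Q_def h_def)
  have prim: "velocity \<Gamma> U = v" "pressure \<Gamma> U = p"
    by (simp_all add: velocity_def pressure_def U_def primitives_conserved[OF G P])
  have F: "(U + directional_flux \<Gamma> \<nu> U) $ 1 = \<rho> * a"
    "(U + directional_flux \<Gamma> \<nu> U) $ 2 = Q * (1 + v \<bullet> \<nu>) * v $ 1 + p * \<nu> $ 1"
    "(U + directional_flux \<Gamma> \<nu> U) $ 3 = Q * (1 + v \<bullet> \<nu>) * v $ 2 + p * \<nu> $ 2"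
    "(U + directional_flux \<Gamma> \<nu> U) $ 4 = Q * (1 + v \<bullet> \<nu>) - p"
    by (simp_all add: directional_flux_def flux_def Let_def prim U sum_2 inner_2 a_def
        null_factor_def L_def algebra_simps)
  have tangent: "L * (dq - v \<bullet> du) = \<zeta>' * relative_lorentz v v' - \<zeta>"
  proof -
    have "L * (dq - v \<bullet> du)
        = \<zeta>' * relative_lorentz v v' - \<zeta> * (L\<^sup>2 * (1 - (norm v)\<^sup>2))"
      unfolding power2_norm_eq_inner power2_eq_square[of L]
      by (simp add: dq_def du_def inner_diff_right relative_lorentz_def L_def[symmetric]
          L'_def[symmetric] algebra_simps)
    then show ?thesis using lorentz_factor_props(2)[OF pos(3)] by (simp add: L_def)
  qed
  have null: "\<nu> \<bullet> du + dq = \<zeta>' * a' - \<zeta> * a"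
    by (simp add: dq_def du_def inner_diff_right a_def a'_def null_factor_def L_def[symmetric]
        L'_def[symmetric] inner_commute[of \<nu>] inner_diff_left algebra_simps)
  have "(U + directional_flux \<Gamma> \<nu> U) \<bullet> (V' - V)
      = \<rho> * a * (V' $ 1 - V $ 1) - Q * (1 + v \<bullet> \<nu>) * (dq - v \<bullet> du) + p * (\<nu> \<bullet> du + dq)"
    unfolding inner_vec_def[of "U + _"] sum_4 F dV by (simp add: inner_2[of _ du] algebra_simps)
  also have "Q * (1 + v \<bullet> \<nu>) * (dq - v \<bullet> du) = \<rho> * a * (h * (L * (dq - v \<bullet> du)))"
    by (simp add: Q_def a_def null_factor_def L_def power2_eq_square)
  also have "p * (\<nu> \<bullet> du + dq) = \<rho> * a * (\<zeta>' * a' / (\<zeta> * a) - 1)"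
    unfolding null \<zeta>(2)[symmetric] using \<zeta>(1) a by (simp add: field_simps)
  finally show ?thesis
    unfolding tangent h V_def[symmetric] V'_def[symmetric] by (simp add: algebra_simps)
qed

lemma characteristic_potential_tangent:
  assumes G: "1 < \<Gamma>" "\<Gamma> \<le> 2" and adm: "admissible \<Gamma> U" "admissible \<Gamma> U'" and \<nu>: "norm \<nu> = 1"
  shows "(U + directional_flux \<Gamma> \<nu> U) \<bullet> (entropy_variables \<Gamma> U' - entropy_variables \<Gamma> U)
    \<le> (potential U' + directional_potential \<Gamma> \<nu> U') - (potential U + directional_potential \<Gamma> \<nu> U)"
proof -
  obtain \<rho> v p where P: "physical \<rho> v p" and U: "U = conserved \<Gamma> \<rho> v p"
    using adm by (auto simp: admissible_def)
  obtain \<rho>' v' p' where P': "physical \<rho>' v' p'" and U': "U' = conserved \<Gamma> \<rho>' v' p'"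
    using adm by (auto simp: admissible_def)
  have pos: "\<rho> > 0" "p > 0" "norm v < 1" "\<rho>' > 0" "p' > 0" "norm v' < 1"
    using P P' by (auto simp: physical_def)
  show ?thesis
    unfolding U U' directional_potential_conserved[OF G P] directional_potential_conserved[OF G P']
      characteristic_pairing[OF G P P' \<nu>]
    by (intro log_convex_tangent Gamma_ratio[OF G] null_factor_pos null_factor_relative_lorentz
        ln_density_entropy_variables[OF G] P P' \<nu> pos divide_pos_pos)
qed

section \<open>Flat estimates in a unit direction\<close>

lemma directional_minus:
  "directional_flux \<Gamma> (- \<nu>) U = - directional_flux \<Gamma> \<nu> U"
  "directional_potential \<Gamma> (- \<nu>) U = - directional_potential \<Gamma> \<nu> U"
  by (simp_all add: directional_flux_def directional_potential_def sum_negf)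

text \<open>\<open>\<Phi>\<close> is half the sum of the characteristic potentials in two opposite directions.\<close>

lemma potential_tangent:
  assumes "1 < \<Gamma>" "\<Gamma> \<le> 2" "admissible \<Gamma> U" "admissible \<Gamma> U'"
  shows "U \<bullet> (entropy_variables \<Gamma> U' - entropy_variables \<Gamma> U) \<le> potential U' - potential U"
proof -
  let ?\<nu> = "axis 1 1 :: real ^ 2"
  have "norm ?\<nu> = 1" "norm (- ?\<nu>) = 1" by simp_all
  from this[THEN characteristic_potential_tangent[OF assms]]
  show ?thesis by (simp add: directional_minus inner_add_left inner_diff_left)
qed

text \<open>The left state contributes the outgoing characteristic flux \<open>U + F\<close> and the right state the
  incoming one, \<open>U - F\<close>.\<close>

lemma directional_lax_friedrichs:
  fixes U\<^sub>m U\<^sub>p :: "real ^ 4"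
  assumes G: "1 < \<Gamma>" "\<Gamma> \<le> 2" and adm: "admissible \<Gamma> U\<^sub>m" "admissible \<Gamma> U\<^sub>p" and \<nu>: "norm \<nu> = 1"
  shows "(entropy_variables \<Gamma> U\<^sub>p - entropy_variables \<Gamma> U\<^sub>m)
      \<bullet> (directional_flux \<Gamma> \<nu> U\<^sub>m + directional_flux \<Gamma> \<nu> U\<^sub>p - (U\<^sub>p - U\<^sub>m))
    \<le> 2 * (directional_potential \<Gamma> \<nu> U\<^sub>p - directional_potential \<Gamma> \<nu> U\<^sub>m)"
proof -
  have "norm (- \<nu>) = 1" using \<nu> by simp
  from characteristic_potential_tangent[OF G adm \<nu>]
    characteristic_potential_tangent[OF G adm(2,1) this]
  show ?thesis
    by (simp add: directional_minus inner_add_left inner_add_right inner_diff_left inner_diff_right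
        inner_commute)
qed

text \<open>The sign of the advection speed selects the state at which the tangent to \<open>\<Phi>\<close> is taken.\<close>

lemma advection_upwind:
  fixes U\<^sub>m U\<^sub>p :: "real ^ 4" and b :: real
  assumes G: "1 < \<Gamma>" "\<Gamma> \<le> 2" and adm: "admissible \<Gamma> U\<^sub>m" "admissible \<Gamma> U\<^sub>p"
  shows "(entropy_variables \<Gamma> U\<^sub>p - entropy_variables \<Gamma> U\<^sub>m)
      \<bullet> (- b *\<^sub>R (U\<^sub>m + U\<^sub>p) - \<bar>b\<bar> *\<^sub>R (U\<^sub>p - U\<^sub>m))
    \<le> - 2 * b * (potential U\<^sub>p - potential U\<^sub>m)"
proof (cases "b \<ge> 0")
  case True
  then have "- b *\<^sub>R (U\<^sub>m + U\<^sub>p) - \<bar>b\<bar> *\<^sub>R (U\<^sub>p - U\<^sub>m) = (- 2 * b) *\<^sub>R U\<^sub>p"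
    by (simp add: vec_eq_iff algebra_simps)
  moreover have "b * (U\<^sub>p \<bullet> (entropy_variables \<Gamma> U\<^sub>m - entropy_variables \<Gamma> U\<^sub>p))
      \<le> b * (potential U\<^sub>m - potential U\<^sub>p)"
    using True by (intro mult_left_mono potential_tangent[OF G] adm)
  ultimately show ?thesis
    by (simp add: inner_diff_left inner_diff_right inner_commute right_diff_distrib)
next
  case False
  then have "- b *\<^sub>R (U\<^sub>m + U\<^sub>p) - \<bar>b\<bar> *\<^sub>R (U\<^sub>p - U\<^sub>m) = (- 2 * b) *\<^sub>R U\<^sub>m"
    by (simp add: vec_eq_iff algebra_simps)
  moreover have "- b * (U\<^sub>m \<bullet> (entropy_variables \<Gamma> U\<^sub>p - entropy_variables \<Gamma> U\<^sub>m))
      \<le> - b * (potential U\<^sub>p - potential U\<^sub>m)"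
    using False by (intro mult_left_mono potential_tangent[OF G] adm) auto
  ultimately show ?thesis
    by (simp add: inner_diff_left inner_diff_right inner_commute right_diff_distrib)
qed

section \<open>Geometry of the face\<close>

lemma vol_nonneg:
  assumes sym: "transpose \<gamma> = \<gamma>" and pd: "positive_definite \<gamma>"
  shows "vol \<gamma> \<ge> 0"
proof -
  define a b c where "a = \<gamma> $ 1 $ 1" and "b = \<gamma> $ 1 $ 2" and "c = \<gamma> $ 2 $ 2"
  have b: "\<gamma> $ 2 $ 1 = b" using arg_cong[OF sym, of "\<lambda>M. M $ 1 $ 2"] by (simp add: transpose_def b_def)
  have pos: "x \<bullet> (\<gamma> *v x) > 0" if "x \<noteq> 0" for x using pd that by (simp add: positive_definite_def)
  have quad: "x \<bullet> (\<gamma> *v x) = a * (x $ 1)\<^sup>2 + 2 * b * x $ 1 * x $ 2 + c * (x $ 2)\<^sup>2" for x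
    by (simp add: inner_2 matrix_vector_mult_def sum_2 a_def b c_def b_def[symmetric]
        power2_eq_square algebra_simps)
  have a: "a > 0" using pos[of "vector [1, 0]"] by (simp add: quad vec_eq_iff forall_2)
  have "a * (a * c - b\<^sup>2) > 0"
    using pos[of "vector [- b, a]"] a
    by (simp add: quad vec_eq_iff forall_2 power2_eq_square algebra_simps)
  then have "det \<gamma> > 0"
    using a by (simp add: det_2 a_def b c_def b_def[symmetric] zero_less_mult_iff power2_eq_square)
  then show ?thesis by (simp add: vol_def)
qed

lemma norm_frame:
  assumes "transpose \<gamma> = \<gamma>" "positive_definite \<gamma>"
  shows "norm (frame \<gamma> *v n) = sqrt (\<Sum>I\<in>UNIV. \<Sum>J\<in>UNIV. matrix_inv \<gamma> $ I $ J * n $ I * n $ J)"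
proof -
  let ?\<Theta> = "frame \<gamma>"
  have "matrix_inv \<gamma> = transpose ?\<Theta> ** ?\<Theta>"
    using is_frame_frame(1)[OF assms] by (simp add: is_frame_def)
  then have "(norm (?\<Theta> *v n))\<^sup>2 = (\<Sum>I\<in>UNIV. \<Sum>J\<in>UNIV. matrix_inv \<gamma> $ I $ J * n $ I * n $ J)"
    by (simp add: power2_norm_eq_inner inner_2 matrix_vector_mult_def sum_2
        matrix_matrix_mult_def transpose_def algebra_simps)
  then show ?thesis by (metis norm_ge_zero real_sqrt_unique)
qed

lemma normal_flux_directional:
  "normal_flux \<Gamma> \<alpha> \<beta> \<gamma> w n U = (w * vol \<gamma>) *\<^sub>R (\<alpha> *\<^sub>R directional_flux \<Gamma> (frame \<gamma> *v n) U
    - (\<Sum>I\<in>UNIV. \<beta> $ I * n $ I) *\<^sub>R U)"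
  by (simp add: vec_eq_iff normal_flux_def weighted_flux_def weighted_A_def weighted_C_def
      directional_flux_def matrix_vector_mult_def sum_2 algebra_simps)

lemma normal_potential_directional:
  "normal_potential \<Gamma> \<alpha> \<beta> \<gamma> w n U = (w * vol \<gamma>) * (\<alpha> * directional_potential \<Gamma> (frame \<gamma> *v n) U
    - (\<Sum>I\<in>UNIV. \<beta> $ I * n $ I) * potential U)"
  by (simp add: normal_potential_def weighted_potential_def weighted_A_def weighted_C_def
      directional_potential_def matrix_vector_mult_def sum_2 algebra_simps)

lemma directional_scaleR:
  "directional_flux \<Gamma> (r *\<^sub>R \<nu>) U = r *\<^sub>R directional_flux \<Gamma> \<nu> U"
  "directional_potential \<Gamma> (r *\<^sub>R \<nu>) U = r * directional_potential \<Gamma> \<nu> U"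
  by (simp_all add: directional_flux_def directional_potential_def scaleR_sum_right sum_distrib_left mult_ac)

section \<open>Entropy stability of the local Lax-Friedrichs flux\<close>

text \<open>The dissipation speed is the light speed \<open>\<alpha> |\<Theta> n|\<close> plus the advection speed \<open>|b|\<close>: the first
  part pays for the flat estimate, the second for the shift.\<close>

lemma llf_flux_entropy_stable:
  fixes \<beta> n :: "real ^ 2" and U\<^sub>m U\<^sub>p :: "real ^ 4"
  assumes G: "1 < \<Gamma>" "\<Gamma> \<le> 2" and "\<alpha> \<ge> 0" "w \<ge> 0"
    and \<gamma>: "transpose \<gamma> = \<gamma>" "positive_definite \<gamma>"
    and adm: "admissible \<Gamma> U\<^sub>m" "admissible \<Gamma> U\<^sub>p"
  shows "(entropy_variables \<Gamma> U\<^sub>p - entropy_variables \<Gamma> U\<^sub>m) \<bullet> llf_flux \<Gamma> \<alpha> \<beta> \<gamma> w n U\<^sub>m U\<^sub>p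
    \<le> normal_potential \<Gamma> \<alpha> \<beta> \<gamma> w n U\<^sub>p - normal_potential \<Gamma> \<alpha> \<beta> \<gamma> w n U\<^sub>m"
proof -
  define r where "r = norm (frame \<gamma> *v n)"
  define b where "b = (\<Sum>I\<in>UNIV. \<beta> $ I * n $ I)"
  define K where "K = w * vol \<gamma>"
  define dV where "dV = entropy_variables \<Gamma> U\<^sub>p - entropy_variables \<Gamma> U\<^sub>m"
  obtain \<nu> where \<nu>: "norm \<nu> = 1" "frame \<gamma> *v n = r *\<^sub>R \<nu>"
  proof (cases "frame \<gamma> *v n = 0")
    case True
    \<comment> \<open>with \<open>r = 0\<close> any unit vector serves\<close>
    then show thesis by (intro that[of "axis 1 1"]) (auto simp: r_def)
  next
    case False
    then show thesis by (intro that[of "frame \<gamma> *v n /\<^sub>R r"]) (auto simp: r_def)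
  qed
  let ?F = "directional_flux \<Gamma> \<nu>" and ?\<psi> = "directional_potential \<Gamma> \<nu>"
  have speed: "causal_speed \<alpha> \<beta> \<gamma> n = \<bar>b\<bar> + \<alpha> * r"
    by (simp add: causal_speed_def b_def r_def norm_frame[OF \<gamma>])
  have "llf_flux \<Gamma> \<alpha> \<beta> \<gamma> w n U\<^sub>m U\<^sub>p = (K / 2) *\<^sub>R ((\<alpha> * r) *\<^sub>R (?F U\<^sub>m + ?F U\<^sub>p - (U\<^sub>p - U\<^sub>m))
      + (- b *\<^sub>R (U\<^sub>m + U\<^sub>p) - \<bar>b\<bar> *\<^sub>R (U\<^sub>p - U\<^sub>m)))"
    unfolding llf_flux_def speed normal_flux_directional \<nu>(2) weighted_state_def directional_scaleR
      K_def[symmetric] b_def[symmetric]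
    by (simp add: vec_eq_iff field_simps)
  then have "dV \<bullet> llf_flux \<Gamma> \<alpha> \<beta> \<gamma> w n U\<^sub>m U\<^sub>p
      = K / 2 * (\<alpha> * r * (dV \<bullet> (?F U\<^sub>m + ?F U\<^sub>p - (U\<^sub>p - U\<^sub>m)))
        + dV \<bullet> (- b *\<^sub>R (U\<^sub>m + U\<^sub>p) - \<bar>b\<bar> *\<^sub>R (U\<^sub>p - U\<^sub>m)))"
    by (simp only: inner_scaleR_right inner_add_right)
  also have "\<dots> \<le> K / 2 * (\<alpha> * r * (2 * (?\<psi> U\<^sub>p - ?\<psi> U\<^sub>m)) + - 2 * b * (potential U\<^sub>p - potential U\<^sub>m))"
    unfolding dV_def using assms vol_nonneg[OF \<gamma>]
    by (intro mult_left_mono add_mono directional_lax_friedrichs advection_upwind \<nu>(1))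
       (auto simp: K_def r_def)
  also have "\<dots> = normal_potential \<Gamma> \<alpha> \<beta> \<gamma> w n U\<^sub>p - normal_potential \<Gamma> \<alpha> \<beta> \<gamma> w n U\<^sub>m"
    unfolding normal_potential_directional \<nu>(2) directional_scaleR K_def[symmetric] b_def[symmetric]
    by (simp add: algebra_simps)
  finally show ?thesis unfolding dV_def .
qed

theorem proposition3p3:
  fixes \<Gamma> \<alpha> w \<epsilon> :: real and \<beta> n :: "real ^ 2" and \<gamma> :: "real ^ 2 ^ 2" and I :: 2
    and U\<^sub>m U\<^sub>p :: "real ^ 4"
  assumes "1 < \<Gamma>" and "\<Gamma> \<le> 2"
    and "\<alpha> > 0" and "w > 0"
    and "transpose \<gamma> = \<gamma>" and "positive_definite \<gamma>"
    and "\<epsilon> \<in> {-1, 1}" and "n = \<epsilon> *\<^sub>R axis I 1"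
    and "admissible \<Gamma> U\<^sub>m" and "admissible \<Gamma> U\<^sub>p"
  shows "(entropy_variables \<Gamma> U\<^sub>p - entropy_variables \<Gamma> U\<^sub>m) \<bullet> llf_flux \<Gamma> \<alpha> \<beta> \<gamma> w n U\<^sub>m U\<^sub>p
           - (normal_potential \<Gamma> \<alpha> \<beta> \<gamma> w n U\<^sub>p - normal_potential \<Gamma> \<alpha> \<beta> \<gamma> w n U\<^sub>m) \<le> 0"
  using llf_flux_entropy_stable[of \<Gamma> \<alpha> w \<gamma> U\<^sub>m U\<^sub>p \<beta> n] assms by simp

end
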